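(* Let $H$ be Higman's group, $H=\langle a_i\ (i\in\mathbb Z/4\mathbb Z)\mid a_i a_{i+1} a_i^{-1}=a_{i+1}^2 \text{ for all } i\in \mathbb Z/4\mathbb Z\rangle$. Every homomorphism $\rho:H\to \mathsf{Diff}^1(\mathbb R)$ is trivial. Likewise, every homomorphism $\rho:H\to\mathsf{Diff}^1(\mathbb S^1)$ is trivial.
   Context: $\mathsf{Diff}^1(M)$ denotes the group of $C^1$-diffeomorphisms of the manifold $M$. *)

theory Defs
  imports "HOL-Analysis.Analysis"
begin

definition C1_real :: "(real \<Rightarrow> real) \<Rightarrow> bool" where
  "C1_real f \<longleftrightarrow> (\<exists>f'. continuous_on UNIV f' \<and> (\<forall>x. (f has_real_derivative f' x) (at x)))"

definition Diff1_real :: "(real \<Rightarrow> real) set" where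
  "Diff1_real = {f. bij f \<and> C1_real f \<and> C1_real (inv f)}"

text \<open>The circle S^1 is the unit circle in the complex plane (an embedded
  submanifold of R^2); a map g : S^1 \<rightarrow> S^1 is C^1 iff its composite with the
  covering parametrisation t \<mapsto> cis t is a C^1 map R \<rightarrow> R^2 = C.\<close>
definition S1 :: "complex set" where
  "S1 = {z. cmod z = 1}"

definition C1_circle :: "(complex \<Rightarrow> complex) \<Rightarrow> bool" where
  "C1_circle g \<longleftrightarrow> g ` S1 \<subseteq> S1 \<and>
     (\<exists>g'. continuous_on UNIV g' \<and>
        (\<forall>t. ((\<lambda>t. g (cis t)) has_vector_derivative g' t) (at t)))"

definition Diff1_circle :: "(complex \<Rightarrow> complex) set" where
  "Diff1_circle = {g. bij_betw g S1 S1 \<and> C1_circle g \<and> C1_circle (inv_into S1 g)}"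

text \<open>A homomorphism from Higman's group
  H = < a_0,a_1,a_2,a_3 | a_i a_{i+1} a_i^{-1} = a_{i+1}^2 (i mod 4) >
  into a group with multiplication gmul and inversion inver is, by the universal
  property of the presentation, the same as a choice of images a b c d of the
  four generators satisfying the four defining relations.\<close>
definition higman_rels ::
  "('g \<Rightarrow> 'g \<Rightarrow> 'g) \<Rightarrow> ('g \<Rightarrow> 'g) \<Rightarrow> 'g \<Rightarrow> 'g \<Rightarrow> 'g \<Rightarrow> 'g \<Rightarrow> bool" where
  "higman_rels gmul inver a b c d \<longleftrightarrow>
     gmul (gmul a b) (inver a) = gmul b b \<and>
     gmul (gmul b c) (inver b) = gmul c c \<and>
     gmul (gmul c d) (inver c) = gmul d d \<and>
     gmul (gmul d a) (inver d) = gmul a a"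

end

theory Submission
  imports Defs
begin

text \<open>Write \<open>F f\<close> for the fixed point set of \<open>f\<close>. All generators preserve orientation, because each
  is conjugate to its own square. The relation \<open>a b a\<^sup>-\<^sup>1 = b\<^sup>2\<close> makes \<open>a\<close> permute the components of the
  complement of \<open>F b\<close>, and on an invariant component \<open>a\<close> moves points away from the middle near
  both ends. So if \<open>F b\<close> is bounded above, then so is \<open>F a\<close>, which has a point beyond all of \<open>F b\<close>; going
  once around the cycle of relations gives a contradiction. Hence all four fixed point sets
  are unbounded in both directions. Then a component of the complement of \<open>F b\<close> that is moved by \<open>a\<close>
  would shrink under \<open>a\<^sup>-\<^sup>1\<close> to a common fixed point of \<open>a\<close> and \<open>b\<close>, which the \<open>C\<^sup>1\<close> condition
  excludes. Therefore the left endpoint of such a component is fixed by \<open>a\<close> and is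
  again the left endpoint of a component for \<open>a\<close>; once more around the cycle it is a global fixed point, and
  Thurston's stability argument (Higman's group is perfect) makes the action trivial nearby, a contradiction.
  An action on the circle lifts to an action on the line.\<close>

subsection \<open>Affine-like pairs of homeomorphisms of the line\<close>

lemma strict_mono_surj_isCont:
  fixes f :: "real \<Rightarrow> real"
  assumes "strict_mono f" "surj f"
  shows "isCont f x"
proof -
  have "continuous_on UNIV f"
    by (rule continuous_onI_mono) (use assms in \<open>auto simp: strict_mono_less_eq\<close>)
  then show ?thesis
    by (simp add: continuous_on_eq_continuous_at)
qed

text \<open>Otherwise the orbit of \<open>x0\<close> is increasing and bounded by \<open>y\<close>,
  and its limit is a fixed point of \<open>b\<close> between \<open>x0\<close> and
  \<open>y\<close>.\<close>

lemma iterates_pass: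
  fixes b :: "real \<Rightarrow> real"
  assumes cont: "\<And>x. isCont b x"
    and up: "\<And>x. x0 \<le> x \<Longrightarrow> x \<le> y \<Longrightarrow> x < b x"
  shows "\<exists>k. y < (b ^^ k) x0"
proof (rule ccontr)
  assume "\<not> ?thesis"
  then have le: "(b ^^ k) x0 \<le> y" for k
    by (simp add: not_less)
  have ge: "x0 \<le> (b ^^ k) x0" for k
  proof (induction k)
    case (Suc k)
    with up[of "(b ^^ k) x0"] le[of k] show ?case by simp
  qed simp
  have "incseq (\<lambda>k. (b ^^ k) x0)"
    using up ge le by (intro incseq_SucI) (simp add: less_imp_le)
  with le obtain L where L: "(\<lambda>k. (b ^^ k) x0) \<longlonglongrightarrow> L"
    using incseq_convergent by blast
  have "(\<lambda>k. b ((b ^^ k) x0)) \<longlonglongrightarrow> b L"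
    using cont L by (rule isCont_tendsto_compose)
  moreover have "(\<lambda>k. b ((b ^^ k) x0)) \<longlonglongrightarrow> L"
    using LIMSEQ_Suc[OF L] by simp
  ultimately have "b L = L"
    by (rule LIMSEQ_unique)
  moreover have "x0 \<le> L" "L \<le> y"
    using L ge le by (auto intro: LIMSEQ_le_const LIMSEQ_le_const2)
  ultimately show False
    using up[of L] by simp
qed

text \<open>These are orientation-preserving actions of the Baumslag-Solitar group BS(1,2). The
  model is \<open>a x = 2 * x\<close>, \<open>b x = x + 1\<close>.\<close>

locale bs_line =
  fixes a b :: "real \<Rightarrow> real"
  assumes mono_a: "strict_mono a" and mono_b: "strict_mono b"
    and surj_a: "surj a" and surj_b: "surj b"
    and rel: "a (b x) = b (b (a x))"
begin

lemma b_iterate: "a ((b ^^ k) x) = (b ^^ (2 * k)) (a x)"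
  by (induction k) (simp_all add: rel)

lemma isCont_a: "isCont a x" and isCont_b: "isCont b x"
  using strict_mono_surj_isCont mono_a mono_b surj_a surj_b by blast+

text \<open>\<open>a\<close> conjugates \<open>b\<close> to its square, and an increasing map has
  the same fixed points as its square.\<close>

lemma a_fixed_b_iff: "b (a x) = a x \<longleftrightarrow> b x = x"
proof
  assume "b x = x"
  then have "b (b (a x)) = a x" using rel[of x] by simp
  then show "b (a x) = a x"
    using strict_monoD[OF mono_b, of "a x" "b (a x)"] strict_monoD[OF mono_b, of "b (a x)" "a x"]
    by linarith
next
  assume "b (a x) = a x"
  then have "a (b x) = a x" by (simp add: rel)
  then show "b x = x" using mono_a by (simp add: strict_mono_eq)
qed

text \<open>Inverting \<open>b\<close> keeps the relation, so the case where \<open>b\<close> moves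
  points down reduces to the case where it moves them up.\<close>

lemma inverse: "bs_line a (inv b)"
proof
  have bij: "bij b" using mono_b surj_b by (simp add: bij_def strict_mono_imp_inj_on)
  have b_inv: "b (inv b y) = y" "inv b (b y) = y" for y
    using bij by (simp_all add: bij_is_surj surj_f_inv_f bij_is_inj)
  show "strict_mono (inv b)"
    by (metis b_inv(1) mono_b strict_mono_def strict_mono_less)
  show "surj (inv b)" using bij bij_imp_bij_inv bij_is_surj by blast
  show "a (inv b x) = inv b (inv b (a x))" for x
    by (metis b_inv rel)
qed (use mono_a surj_a in auto)

text \<open>Conjugation by the reflection at 0 transfers every statement about upper ends to lower
  ends.\<close>

lemma reflection: "bs_line (\<lambda>x. - a (- x)) (\<lambda>x. - b (- x))"
proof
  show "surj (\<lambda>x. - a (- x))" "surj (\<lambda>x. - b (- x))"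
    using surj_a surj_b by (metis minus_minus surj_def)+
qed (use mono_a mono_b rel in \<open>auto simp: strict_mono_def\<close>)

text \<open>With \<open>b\<close> in the role of a translation, \<open>a\<close> doubles the exponent of \<open>b\<close> along an orbit of \<open>b\<close>
  and so wins against any bounded initial displacement.\<close>

lemma pushes_up_of_pos:
  assumes interval: "\<And>x y z. x \<in> J \<Longrightarrow> z \<in> J \<Longrightarrow> x \<le> y \<Longrightarrow> y \<le> z \<Longrightarrow> y \<in> J"
    and "a ` J \<subseteq> J" "b ` J \<subseteq> J" "J \<noteq> {}" and up: "\<And>x. x \<in> J \<Longrightarrow> x < b x"
  shows "\<exists>t\<in>J. \<forall>y\<in>J. t \<le> y \<longrightarrow> y < a y"
proof -
  obtain x0 where x0: "x0 \<in> J" using assms by blast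
  have J: "(b ^^ k) x \<in> J" if "x \<in> J" for x k
    using that \<open>b ` J \<subseteq> J\<close> by (induction k) auto
  have mono: "strict_mono (b ^^ k)" for k
    using mono_b by (induction k) (auto simp: strict_mono_def)
  have incr: "(b ^^ i) x \<le> (b ^^ j) x" if "i \<le> j" "x \<in> J" for i j x
    using that(1)
  proof (induction j rule: dec_induct)
    case (step n)
    with up[OF J[OF that(2), of n]] show ?case by simp
  qed simp
  have pass: "\<exists>k. y < (b ^^ k) x" if "x \<in> J" "y \<in> J" for x y
    using interval[OF that] up by (intro iterates_pass isCont_b) blast
  \<comment> \<open>\<open>m\<close> applications of \<open>b\<close> compensate whatever
    \<open>a\<close> does to the base point \<open>x0\<close>.\<close>
  obtain m where m: "x0 < (b ^^ m) (a x0)"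
    using pass[of "a x0" x0] x0 \<open>a ` J \<subseteq> J\<close> by blast
  have "y < a y" if y: "y \<in> J" "(b ^^ (m + 2)) x0 \<le> y" for y
  proof -
    \<comment> \<open>For \<open>N = Suc k\<close>, \<open>y\<close> lies between the iterates of
      \<open>x0\<close> with exponents \<open>k\<close> and \<open>k + 1\<close>. The map
      \<open>a\<close> sends the former to a point not below the iterate with exponent
      \<open>2 * k - m\<close>, which is at least \<open>k + 1\<close> since \<open>k\<close> is at
      least \<open>m + 2\<close>.\<close>
    define N where "N = (LEAST k. y < (b ^^ k) x0)"
    have N: "y < (b ^^ N) x0"
      unfolding N_def using pass[OF x0 y(1)] by (rule LeastI_ex)
    have "m + 2 < N"
      using incr[OF _ x0, of N "m + 2"] N y(2) by (meson leD le_less_trans not_le order_trans)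
    then obtain k where k: "N = Suc k" "m + 2 \<le> k" by (cases N) auto
    have "\<not> y < (b ^^ k) x0"
      using k(1) N_def not_less_Least by (metis lessI)
    have "y < (b ^^ Suc k) x0" using N k by simp
    also have "\<dots> \<le> (b ^^ (2 * k - m)) x0" using k by (intro incr x0) auto
    also have "\<dots> \<le> (b ^^ (2 * k - m)) ((b ^^ m) (a x0))"
      using m mono by (simp add: strict_mono_less_eq)
    also have "\<dots> = (b ^^ (2 * k)) (a x0)"
      using k funpow_add[of "2 * k - m" m b] by simp
    also have "\<dots> = a ((b ^^ k) x0)" by (simp add: b_iterate)
    also have "\<dots> \<le> a y"
      using \<open>\<not> y < (b ^^ k) x0\<close> mono_a by (simp add: strict_mono_less_eq)
    finally show ?thesis .
  qed
  then show ?thesis using J[OF x0] by blast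
qed

text \<open>\<open>J\<close> is connected, so a fixed-point-free \<open>b\<close> moves all of
  \<open>J\<close> in one direction. If that is downwards, \<open>inv b\<close> takes its
  place.\<close>

lemma pushes_up:
  assumes interval: "\<And>x y z. x \<in> J \<Longrightarrow> z \<in> J \<Longrightarrow> x \<le> y \<Longrightarrow> y \<le> z \<Longrightarrow> y \<in> J"
    and aJ: "a ` J \<subseteq> J" and bJ: "b ` J = J" and "J \<noteq> {}" and free: "\<And>x. x \<in> J \<Longrightarrow> b x \<noteq> x"
  shows "\<exists>t\<in>J. \<forall>y\<in>J. t \<le> y \<longrightarrow> y < a y"
proof (cases "\<forall>x\<in>J. x < b x")
  case True
  show ?thesis
    by (rule pushes_up_of_pos[OF interval aJ _ \<open>J \<noteq> {}\<close>]) (use bJ True in auto)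
next
  case False
  then obtain x where x: "x \<in> J" "b x < x" using free by (meson linorder_neqE)
  have down: "b y < y" if y: "y \<in> J" for y
  proof (rule ccontr)
    assume "\<not> b y < y"
    then have "y < b y" using free[OF y] by simp
    have "connected J"
      unfolding connected_iff_interval using interval by blast
    moreover have "continuous_on J (\<lambda>x. b x - x)"
      by (intro continuous_at_imp_continuous_on ballI continuous_intros isCont_b)
    ultimately have "connected ((\<lambda>x. b x - x) ` J)"
      by (metis connected_continuous_image)
    then have "0 \<in> (\<lambda>x. b x - x) ` J"
      using x y \<open>y < b y\<close>
      by (elim connectedD_interval[of _ "b x - x" "b y - y"]) auto
    then show False using free by auto
  qed
  interpret i: bs_line a "inv b" by (rule inverse)
  have inv: "inv b (b y) = y" for y
    using mono_b by (simp add: strict_mono_imp_inj_on)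
  have "inv b ` J \<subseteq> J" using inv by (subst bJ[symmetric]) (simp add: image_image)
  moreover have "y < inv b y" if "y \<in> J" for y
  proof -
    obtain z where "z \<in> J" "y = b z" using bJ \<open>y \<in> J\<close> by blast
    then show ?thesis using down inv by simp
  qed
  ultimately show ?thesis
    using \<open>J \<noteq> {}\<close> by (intro i.pushes_up_of_pos[OF interval aJ])
qed

lemma pushes_down:
  assumes interval: "\<And>x y z. x \<in> J \<Longrightarrow> z \<in> J \<Longrightarrow> x \<le> y \<Longrightarrow> y \<le> z \<Longrightarrow> y \<in> J"
    and aJ: "a ` J \<subseteq> J" and bJ: "b ` J = J" and "J \<noteq> {}" and free: "\<And>x. x \<in> J \<Longrightarrow> b x \<noteq> x"
  shows "\<exists>t\<in>J. \<forall>y\<in>J. y \<le> t \<longrightarrow> a y < y"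
proof -
  interpret r: bs_line "\<lambda>x. - a (- x)" "\<lambda>x. - b (- x)" by (rule reflection)
  have "\<exists>t\<in>uminus ` J. \<forall>y\<in>uminus ` J. t \<le> y \<longrightarrow> y < - a (- y)"
  proof (rule r.pushes_up)
    show "y \<in> uminus ` J" if "x \<in> uminus ` J" "z \<in> uminus ` J" "x \<le> y" "y \<le> z" for x y z
      using interval[of "-z" "-x" "-y"] that by force
    show "(\<lambda>x. - a (- x)) ` uminus ` J \<subseteq> uminus ` J" using aJ by auto
    show "(\<lambda>x. - b (- x)) ` uminus ` J = uminus ` J" using arg_cong[OF bJ, of "image uminus"] by (simp add: image_image)
    show "- b (- x) \<noteq> x" if "x \<in> uminus ` J" for x
      using free that by force
  qed (use \<open>J \<noteq> {}\<close> in simp)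
  then show ?thesis by force
qed

text \<open>The ray above all fixed points of \<open>b\<close> is invariant under both maps. On it
  \<open>a\<close> moves points up far out and down near the lower end, so \<open>a\<close> has a
  fixed point in the ray and none far out.\<close>

lemma fixed_points_bdd_above_propagate:
  assumes "bdd_above {x. b x = x}"
  shows "bdd_above {x. a x = x} \<and> (\<exists>p. a p = p \<and> (\<forall>z. b z = z \<longrightarrow> z < p))"
proof -
  \<comment> \<open>If \<open>b\<close> has no fixed point, this is the whole line; the argument
    covers that case as well.\<close>
  define J where "J = {x. \<forall>z. b z = z \<longrightarrow> z < x}"
  obtain M where "\<And>z. b z = z \<Longrightarrow> z \<le> M" using assms by (auto simp: bdd_above_def)
  then have "M + 1 \<in> J" unfolding J_def by force
  have interval: "y \<in> J" if "x \<in> J" "x \<le> y" for x y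
    using that by (force simp: J_def)
  have "z < a x" if "x \<in> J" "b z = z" for x z
  proof -
    obtain w where w: "z = a w" using surj_a by blast
    with that a_fixed_b_iff have "w < x" by (auto simp: J_def)
    with w mono_a show ?thesis by (simp add: strict_mono_less)
  qed
  then have aJ: "a ` J \<subseteq> J" unfolding J_def by blast
  have b_less: "z < b x \<longleftrightarrow> z < x" if "b z = z" for x z
    using that mono_b by (metis strict_mono_less)
  have bJ: "b ` J = J"
  proof
    show "b ` J \<subseteq> J" using b_less by (auto simp: J_def)
    show "J \<subseteq> b ` J"
    proof
      fix y assume "y \<in> J"
      moreover obtain x where "y = b x" using surj_b by blast
      ultimately show "y \<in> b ` J" using b_less by (auto simp: J_def)
    qed
  qed
  have free: "b x \<noteq> x" if "x \<in> J" for x using that by (auto simp: J_def)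
  obtain t where t: "t \<in> J" "\<And>y. y \<in> J \<Longrightarrow> t \<le> y \<Longrightarrow> y < a y"
    using pushes_up[OF _ aJ bJ _ free] interval \<open>M + 1 \<in> J\<close> by blast
  obtain s where s: "s \<in> J" "\<And>y. y \<in> J \<Longrightarrow> y \<le> s \<Longrightarrow> a y < y"
    using pushes_down[OF _ aJ bJ _ free] interval \<open>M + 1 \<in> J\<close> by blast
  \<comment> \<open>\<open>a\<close> moves \<open>t\<close> up, whereas it moves every point of
    \<open>J\<close> up to \<open>s\<close> down.\<close>
  have "s < t" using s t by (meson less_asym not_le order_refl linorder_le_cases)
  have "\<exists>p\<ge>s. p \<le> t \<and> a p - p = 0"
    using s t \<open>s < t\<close>
    by (intro IVT') (auto intro!: continuous_at_imp_continuous_on continuous_intros isCont_a less_imp_le)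
  then obtain p where p: "s \<le> p" "a p = p" by auto
  then have "p \<in> J" using interval s by blast
  have "x \<le> t" if "a x = x" for x
    using t(2)[of x] that interval[OF t(1), of x] by force
  then have "bdd_above {x. a x = x}" by (auto simp: bdd_above_def)
  with p \<open>p \<in> J\<close> show ?thesis by (auto simp: J_def)
qed

end

section \<open>Bounded components of the complement of a fixed point set\<close>

definition gap :: "(real \<Rightarrow> real) \<Rightarrow> real \<Rightarrow> real \<Rightarrow> bool" where
  "gap f u v \<longleftrightarrow> u < v \<and> f u = u \<and> f v = v \<and> (\<forall>x. u < x \<and> x < v \<longrightarrow> f x \<noteq> x)"

lemma first_fixed_point_above:
  fixes f :: "real \<Rightarrow> real"
  assumes cont: "\<And>x. isCont f x" and "f z = z" "x \<le> z"
  obtains v where "x \<le> v" "f v = v" "\<And>y. x \<le> y \<Longrightarrow> y < v \<Longrightarrow> f y \<noteq> y"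
proof -
  define F where "F = {y. x \<le> y \<and> f y = y}"
  have "F = {x..} \<inter> {y. f y = y}" by (auto simp: F_def)
  moreover have "closed {y. f y = y}"
    by (intro closed_Collect_eq continuous_at_imp_continuous_on ballI cont continuous_intros)
  ultimately have "closed F" by auto
  moreover have bdd: "bdd_below F" and "F \<noteq> {}"
    using assms by (auto simp: F_def bdd_below_def)
  ultimately have "Inf F \<in> F" by (rule_tac closed_contains_Inf) auto
  moreover have "f y \<noteq> y" if "x \<le> y" "y < Inf F" for y
    using cInf_lower[OF _ bdd, of y] that by (auto simp: F_def)
  ultimately show thesis using that by (auto simp: F_def)
qed

lemma last_fixed_point_below:
  fixes f :: "real \<Rightarrow> real"
  assumes cont: "\<And>x. isCont f x" and "f z = z" "z \<le> x"
  obtains u where "u \<le> x" "f u = u" "\<And>y. y \<le> x \<Longrightarrow> u < y \<Longrightarrow> f y \<noteq> y"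
proof -
  have "isCont (\<lambda>x. - f (- x)) x" for x
    by (intro continuous_intros isCont_o2[OF _ cont])
  with assms obtain v where "- x \<le> v" "- f (- v) = v" "\<And>y. - x \<le> y \<Longrightarrow> y < v \<Longrightarrow> - f (- y) \<noteq> y"
    by (rule_tac f = "\<lambda>x. - f (- x)" and x = "-x" and z = "-z" in first_fixed_point_above) auto
  from this(1,2) this(3)[of "- y" for y] show thesis
    by (intro that[of "- v"]) force+
qed

text \<open>Unboundedness gives fixed points on both sides of \<open>x\<close>; the nearest ones
  bound the gap.\<close>

lemma gap_around:
  fixes f :: "real \<Rightarrow> real"
  assumes cont: "\<And>x. isCont f x" and "f x \<noteq> x"
    and "\<not> bdd_above {x. f x = x}" "\<not> bdd_below {x. f x = x}"
  obtains u v where "gap f u v"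
proof -
  obtain z z' where z: "f z = z" "z \<le> x" "f z' = z'" "x \<le> z'"
    using assms(3,4) unfolding bdd_above_def bdd_below_def
    by (metis (mono_tags, lifting) linorder_le_cases mem_Collect_eq)
  obtain v where "x \<le> v" "f v = v" "\<And>y. x \<le> y \<Longrightarrow> y < v \<Longrightarrow> f y \<noteq> y"
    using first_fixed_point_above[OF cont z(3,4)] by blast
  moreover obtain u where "u \<le> x" "f u = u" "\<And>y. y \<le> x \<Longrightarrow> u < y \<Longrightarrow> f y \<noteq> y"
    using last_fixed_point_below[OF cont z(1,2)] by blast
  moreover have "u < v" using \<open>u \<le> x\<close> \<open>x \<le> v\<close> \<open>f u = u\<close> \<open>f v = v\<close> \<open>f x \<noteq> x\<close>
    by (metis le_less_trans order_le_less)
  ultimately show thesis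
    by (intro that[of u v]) (metis gap_def less_imp_le linorder_le_cases)
qed

context bs_line
begin

text \<open>\<open>a\<close> permutes the fixed points of \<open>b\<close>, so it also fixes the
  next one, \<open>v\<close>. On the invariant interval \<open>a\<close> moves points down near
  \<open>u\<close>, so fixed points of \<open>a\<close> do not accumulate at \<open>u\<close> from
  above. The right endpoint may change.\<close>

lemma gap_inherited:
  assumes gap: "gap b u v" and "a u = u"
  shows "\<exists>w. gap a u w"
proof -
  have uv: "u < v" "b u = u" "b v = v" and free: "\<And>x. u < x \<Longrightarrow> x < v \<Longrightarrow> b x \<noteq> x"
    using gap by (auto simp: gap_def)
  \<comment> \<open>\<open>v\<close> is the least fixed point of \<open>b\<close> above
    \<open>u\<close>. Both \<open>a v\<close> and the preimage \<open>w\<close> of \<open>v\<close>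
    under \<open>a\<close> are fixed points of \<open>b\<close> above \<open>u\<close>, hence not
    below \<open>v\<close>.\<close>
  have "a v = v"
  proof (rule antisym)
    obtain w where w: "v = a w" using surj_a by blast
    then have "b w = w" "u < w"
      using a_fixed_b_iff[of w] uv strict_mono_less[OF mono_a, of u w] \<open>a u = u\<close> by simp_all
    then have "v \<le> w" using free by (meson not_le)
    show "v \<le> a v"
    proof (rule ccontr)
      assume "\<not> v \<le> a v"
      moreover have "u < a v" using uv mono_a \<open>a u = u\<close> by (metis strict_mono_less)
      moreover have "b (a v) = a v" using uv a_fixed_b_iff by blast
      ultimately show False using free[of "a v"] by simp
    qed
    show "a v \<le> v"
      using \<open>v \<le> w\<close> w mono_a by (metis strict_mono_less_eq)
  qed
  have sm: "f ` {u<..<v} = {u<..<v}" if f: "strict_mono f" "surj f" "f u = u" "f v = v" for f :: "real \<Rightarrow> real"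
  proof
    show "f ` {u<..<v} \<subseteq> {u<..<v}"
      using strict_mono_less[OF f(1), of u] strict_mono_less[OF f(1), of _ v] f(3,4) by auto
    show "{u<..<v} \<subseteq> f ` {u<..<v}"
    proof
      fix y assume "y \<in> {u<..<v}"
      moreover obtain x where "y = f x" using f(2) by blast
      ultimately show "y \<in> f ` {u<..<v}"
        using strict_mono_less[OF f(1), of u x] strict_mono_less[OF f(1), of x v] f(3,4) by auto
    qed
  qed
  have "a ` {u<..<v} = {u<..<v}" "b ` {u<..<v} = {u<..<v}"
    using sm[OF mono_a surj_a \<open>a u = u\<close> \<open>a v = v\<close>] sm[OF mono_b surj_b uv(2,3)] by this
  then have "\<exists>t\<in>{u<..<v}. \<forall>y\<in>{u<..<v}. y \<le> t \<longrightarrow> a y < y"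
  proof (intro pushes_down)
    show "{u<..<v} \<noteq> {}" using \<open>u < v\<close> by simp
    show "b x \<noteq> x" if "x \<in> {u<..<v}" for x using free that by simp
  qed auto
  then obtain t where t: "u < t" "t < v" and
    down: "\<And>y. y \<in> {u<..<v} \<Longrightarrow> y \<le> t \<Longrightarrow> a y < y"
    by (metis greaterThanLessThan_iff)
  obtain w where w: "t \<le> w" "a w = w" "\<And>y. t \<le> y \<Longrightarrow> y < w \<Longrightarrow> a y \<noteq> y"
    using first_fixed_point_above[OF isCont_a \<open>a v = v\<close>, of t] \<open>t < v\<close> by (metis less_imp_le)
  have "a y \<noteq> y" if "u < y" "y < w" for y
    using down[of y] \<open>t < v\<close> w(3)[of y] that by (cases "y \<le> t") simp_all
  with t(1) w(1,2) \<open>a u = u\<close> show ?thesis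
    by (intro exI[of _ w]) (simp add: gap_def)
qed

end

subsection \<open>Consequences of differentiability\<close>

text \<open>This is strict differentiability at \<open>q\<close> with derivative \<open>m\<close>.
  As both points vary, it controls the distortion of small intervals near \<open>q\<close> that need
  not contain \<open>q\<close>.\<close>

definition strict_deriv_at :: "(real \<Rightarrow> real) \<Rightarrow> real \<Rightarrow> real \<Rightarrow> bool" where
  "strict_deriv_at f m q \<longleftrightarrow>
     (\<forall>\<epsilon>>0. \<exists>r>0. \<forall>x y. \<bar>x - q\<bar> < r \<and> \<bar>y - q\<bar> < r \<longrightarrow> \<bar>f x - f y - m * (x - y)\<bar> \<le> \<epsilon> * \<bar>x - y\<bar>)"

text \<open>The mean value inequality is applied to \<open>f x - f' q * x\<close>, whose derivative
  is small near \<open>q\<close>.\<close>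

lemma C1_strict_deriv_at:
  assumes cont: "continuous_on UNIV f'" and der: "\<And>x. (f has_real_derivative f' x) (at x)"
  shows "strict_deriv_at f (f' q) q"
  unfolding strict_deriv_at_def
proof (intro allI impI)
  fix \<epsilon> :: real assume "\<epsilon> > 0"
  moreover have "isCont f' q" using cont by (simp add: continuous_on_eq_continuous_at)
  ultimately obtain r where r: "r > 0" "\<And>x. \<bar>x - q\<bar> < r \<Longrightarrow> \<bar>f' x - f' q\<bar> < \<epsilon>"
    unfolding continuous_at_eps_delta dist_real_def by blast
  have "\<bar>f x - f y - f' q * (x - y)\<bar> \<le> \<epsilon> * \<bar>x - y\<bar>" if "\<bar>x - q\<bar> < r" "\<bar>y - q\<bar> < r" for x y
  proof -
    have "norm ((f x - f' q * x) - (f y - f' q * y)) \<le> \<epsilon> * norm (x - y)"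
    proof (rule field_differentiable_bound)
      show "convex (ball q r)" by simp
      show "((\<lambda>x. f x - f' q * x) has_real_derivative f' z - f' q) (at z within ball q r)" for z
        by (rule derivative_eq_intros has_field_derivative_at_within[OF der] refl | simp)+
      show "norm (f' z - f' q) \<le> \<epsilon>" if "z \<in> ball q r" for z
        using r(2)[of z] that by (simp add: dist_real_def abs_minus_commute less_imp_le)
    qed (use that in \<open>auto simp: dist_real_def abs_minus_commute\<close>)
    then show ?thesis by (simp add: algebra_simps)
  qed
  with \<open>r > 0\<close> show "\<exists>r>0. \<forall>x y. \<bar>x - q\<bar> < r \<and> \<bar>y - q\<bar> < r \<longrightarrow>
      \<bar>f x - f y - f' q * (x - y)\<bar> \<le> \<epsilon> * \<bar>x - y\<bar>" by blast
qed

lemma Diff1_real_derivative: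
  assumes "f \<in> Diff1_real"
  obtains f' where "continuous_on UNIV f'" "\<And>x. (f has_real_derivative f' x) (at x)" "\<And>x. f' x \<noteq> 0"
proof -
  from assms have "bij f" and "C1_real f" "C1_real (inv f)"
    by (auto simp: Diff1_real_def)
  then obtain f' g' where f': "continuous_on UNIV f'" "\<And>x. (f has_real_derivative f' x) (at x)"
    and g': "\<And>x. (inv f has_real_derivative g' x) (at x)"
    unfolding C1_real_def by blast
  have "f' x \<noteq> 0" for x
  proof -
    have "((inv f \<circ> f) has_real_derivative g' (f x) * f' x) (at x)"
      by (rule DERIV_chain[OF g' f'(2)])
    moreover have "inv f \<circ> f = (\<lambda>x. x)" using \<open>bij f\<close> by (auto simp: bij_is_inj)
    ultimately have "((\<lambda>x. x) has_real_derivative g' (f x) * f' x) (at x)" by simp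
    then have "g' (f x) * f' x = 1" using DERIV_unique DERIV_ident by blast
    then show ?thesis by auto
  qed
  with f' show thesis by (rule that)
qed

lemma Diff1_real_inv: "f \<in> Diff1_real \<Longrightarrow> inv f \<in> Diff1_real"
  by (auto simp: Diff1_real_def bij_imp_bij_inv inv_inv_eq)

lemma C1_real_isCont: "C1_real f \<Longrightarrow> isCont f x"
  by (auto simp: C1_real_def intro: DERIV_isCont)

lemma Diff1_real_isCont: "f \<in> Diff1_real \<Longrightarrow> isCont f x"
  by (simp add: Diff1_real_def C1_real_isCont)

text \<open>By the chain rule, the derivatives at \<open>q\<close> satisfy
  \<open>a' q * b' q = b' q * (b' q * a' q)\<close>, and both are nonzero.\<close>

lemma common_fixed_strict_deriv_one:
  assumes "a \<in> Diff1_real" "b \<in> Diff1_real" and rel: "\<And>x. a (b x) = b (b (a x))"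
    and q: "a q = q" "b q = q"
  shows "strict_deriv_at b 1 q"
proof -
  obtain a' where "continuous_on UNIV a'"
    and a': "\<And>x. (a has_real_derivative a' x) (at x)" "\<And>x. a' x \<noteq> 0"
    by (rule Diff1_real_derivative[OF assms(1)]) (rule that)
  obtain b' where b': "continuous_on UNIV b'" "\<And>x. (b has_real_derivative b' x) (at x)" "\<And>x. b' x \<noteq> 0"
    by (rule Diff1_real_derivative[OF assms(2)]) (rule that)
  have "((\<lambda>x. a (b x)) has_real_derivative a' q * b' q) (at q)"
    using DERIV_chain2[of a "a' (b q)" b q "b' q"] a' b' q by simp
  moreover have "((\<lambda>x. b (b (a x))) has_real_derivative b' q * (b' q * a' q)) (at q)"
    using DERIV_chain2[of b "b' (b (a q))" "\<lambda>x. b (a x)" q "b' q * a' q"]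
      DERIV_chain2[of b "b' (a q)" a q "a' q"] a' b' q by simp
  ultimately have "a' q * b' q = b' q * (b' q * a' q)"
    unfolding rel by (rule DERIV_unique)
  then have "b' q = 1" using a'(2)[of q] b'(3)[of q] by simp
  with C1_strict_deriv_at[OF b'(1,2), of q] show ?thesis by simp
qed

text \<open>Since \<open>b'(q) = 1\<close>, each application of \<open>e\<close> doubles, asymptotically, the displacement of \<open>b\<close>
  relative to the length of the interval that contains it.\<close>

lemma no_shrinking_copies:
  fixes e b :: "real \<Rightarrow> real"
  assumes mono_e: "strict_mono e" and mono_b: "strict_mono b" and rel: "\<And>x. b (e x) = e (b (b x))"
    and der_e: "strict_deriv_at e \<nu> q" "\<nu> > 0" and der_b: "strict_deriv_at b 1 q"
    and uv: "b u = u" "b v = v" and x: "u < x" "x < v" "b x \<noteq> x"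
    and u_lim: "(\<lambda>n. (e ^^ n) u) \<longlonglongrightarrow> q" and v_lim: "(\<lambda>n. (e ^^ n) v) \<longlonglongrightarrow> q"
  shows False
proof -
  obtain r1 where r1: "r1 > 0" "\<And>x y. \<bar>x - q\<bar> < r1 \<Longrightarrow> \<bar>y - q\<bar> < r1 \<Longrightarrow>
      \<bar>e x - e y - \<nu> * (x - y)\<bar> \<le> \<nu> / 20 * \<bar>x - y\<bar>"
    using der_e unfolding strict_deriv_at_def by (metis divide_pos_pos zero_less_numeral)
  obtain r2 where r2: "r2 > 0" "\<And>x y. \<bar>x - q\<bar> < r2 \<Longrightarrow> \<bar>y - q\<bar> < r2 \<Longrightarrow>
      \<bar>b x - b y - (x - y)\<bar> \<le> 1 / 20 * \<bar>x - y\<bar>"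
    using der_b unfolding strict_deriv_at_def by (metis divide_pos_pos zero_less_numeral zero_less_one mult_1)
  \<comment> \<open>The iterated images of the interval and of the moved point: their endpoints stay
    fixed by \<open>b\<close> and both tend to \<open>q\<close>.\<close>
  define U V X where "U n = (e ^^ n) u" and "V n = (e ^^ n) v" and "X n = (e ^^ n) x" for n
  have fix_e: "b (e z) = e z" if "b z = z" for z
    using rel[of z] that by simp
  have bU: "b (U n) = U n" and bV: "b (V n) = V n" for n
    using uv fix_e unfolding U_def V_def by (induction n) auto
  have UXV: "U n < X n" "X n < V n" for n
    using x mono_e unfolding U_def V_def X_def by (induction n) (auto simp: strict_mono_def)
  have bX: "U n < b (X n)" "b (X n) < V n" "U n < b (b (X n))" "b (b (X n)) < V n" for n
    using UXV bU bV mono_b by (metis strict_mono_less)+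
  have X_moved: "b (X n) \<noteq> X n" for n
  proof (induction n)
    case (Suc n)
    then have "b (b (X n)) \<noteq> X n"
      using strict_monoD[OF mono_b, of "X n" "b (X n)"] strict_monoD[OF mono_b, of "b (X n)" "X n"]
      by linarith
    then show ?case using mono_e by (simp add: X_def rel strict_mono_eq)
  qed (use x in \<open>simp add: X_def\<close>)
  \<comment> \<open>Displacement of \<open>b\<close> at \<open>X n\<close> against the length of the
    interval around it; \<open>b (X n)\<close> stays in that interval.\<close>
  define l w where "l n = \<bar>b (X n) - X n\<bar>" and "w n = V n - U n" for n
  have l_pos: "l n > 0" and l_le: "l n \<le> w n" for n
    using X_moved UXV[of n] bX[of n] unfolding l_def w_def by auto
  obtain N where N: "\<And>n. n \<ge> N \<Longrightarrow> \<bar>U n - q\<bar> < min r1 r2 \<and> \<bar>V n - q\<bar> < min r1 r2"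
  proof -
    have "\<forall>\<^sub>F n in sequentially. dist (U n) q < min r1 r2 \<and> dist (V n) q < min r1 r2"
      using u_lim v_lim r1 r2 unfolding U_def V_def by (intro eventually_conj tendstoD) auto
    then show thesis using that by (auto simp: eventually_sequentially dist_real_def)
  qed
  \<comment> \<open>Since \<open>b (e z) = e (b (b z))\<close>, the new displacement is the
    \<open>e\<close>-image of that of the square of \<open>b\<close>, which is nearly
    \<open>2 * l n\<close>. The errors of 1/20 leave the factor 19/20 * 39/20, which exceeds 3/2 *
    21/20.\<close>
  have step: "l (Suc n) \<ge> 3 / 2 * (21 / 20 * \<nu>) * l n" "w (Suc n) \<le> 21 / 20 * \<nu> * w n" if "n \<ge> N" for n
  proof -
    have near: "\<bar>z - q\<bar> < r1" "\<bar>z - q\<bar> < r2" if "U n \<le> z" "z \<le> V n" for z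
      using N[OF \<open>n \<ge> N\<close>] that by auto
    have nX: "U n \<le> X n" "X n \<le> V n" "U n \<le> b (X n)" "b (X n) \<le> V n"
        "U n \<le> b (b (X n))" "b (b (X n)) \<le> V n" "U n \<le> V n"
      using UXV[of n] bX[of n] by auto
    have "\<bar>b (b (X n)) - b (X n) - (b (X n) - X n)\<bar> \<le> 1 / 20 * l n"
      unfolding l_def using nX by (intro r2 near)
    then have two: "\<bar>b (b (X n)) - X n\<bar> \<ge> 39 / 20 * l n"
      unfolding l_def by (auto simp: abs_if split: if_splits)
    let ?d = "b (b (X n)) - X n"
    have "\<bar>e (b (b (X n))) - e (X n) - \<nu> * ?d\<bar> \<le> \<nu> / 20 * \<bar>?d\<bar>"
      using nX by (intro r1 near)
    moreover have "\<bar>\<nu> * ?d\<bar> = \<nu> * \<bar>?d\<bar>" using \<open>\<nu> > 0\<close> by (simp add: abs_mult)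
    ultimately have "\<bar>e (b (b (X n))) - e (X n)\<bar> \<ge> 19 / 20 * (\<nu> * \<bar>?d\<bar>)"
      using abs_triangle_ineq2[of "\<nu> * ?d" "e (b (b (X n))) - e (X n)"]
        abs_minus_commute[of "\<nu> * ?d" "e (b (b (X n))) - e (X n)"]
      by linarith
    moreover have "l (Suc n) = \<bar>e (b (b (X n))) - e (X n)\<bar>"
      by (simp add: l_def X_def rel)
    ultimately have "l (Suc n) \<ge> 19 / 20 * (\<nu> * \<bar>?d\<bar>)" by simp
    moreover have "\<nu> * \<bar>?d\<bar> \<ge> \<nu> * (39 / 20 * l n)"
      using two \<open>\<nu> > 0\<close> by (intro mult_left_mono) auto
    moreover have "\<nu> * l n > 0" using \<open>\<nu> > 0\<close> l_pos by simp
    ultimately show "l (Suc n) \<ge> 3 / 2 * (21 / 20 * \<nu>) * l n" by simp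
    have "\<bar>e (V n) - e (U n) - \<nu> * (V n - U n)\<bar> \<le> \<nu> / 20 * \<bar>V n - U n\<bar>"
      using nX by (intro r1 near) auto
    moreover have "w (Suc n) = e (V n) - e (U n)" by (simp add: w_def U_def V_def)
    moreover have "\<bar>V n - U n\<bar> = w n" using nX by (simp add: w_def)
    ultimately show "w (Suc n) \<le> 21 / 20 * \<nu> * w n" unfolding w_def by linarith
  qed
  \<comment> \<open>Cross-multiplied form of the growth of \<open>l n / w n\<close> by 3/2 per step;
    this quotient never exceeds 1.\<close>
  have growth: "(3 / 2) ^ k * l N * w (N + k) \<le> w N * l (N + k)" for k
  proof (induction k)
    case (Suc k)
    have lpos: "l N \<ge> 0" "w N \<ge> 0" using l_pos[of N] l_le[of N] by auto
    have "(3 / 2) ^ Suc k * l N * w (N + Suc k) \<le> (3 / 2) ^ Suc k * l N * (21 / 20 * \<nu> * w (N + k))"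
      using step(2)[of "N + k"] lpos by (intro mult_left_mono) auto
    also have "\<dots> = 3 / 2 * (21 / 20 * \<nu>) * ((3 / 2) ^ k * l N * w (N + k))" by simp
    also have "\<dots> \<le> 3 / 2 * (21 / 20 * \<nu>) * (w N * l (N + k))"
      using Suc \<open>\<nu> > 0\<close> by (intro mult_left_mono) auto
    also have "\<dots> = w N * (3 / 2 * (21 / 20 * \<nu>) * l (N + k))" by simp
    also have "\<dots> \<le> w N * l (N + Suc k)"
      using step(1)[of "N + k"] lpos by (intro mult_left_mono) auto
    finally show ?case .
  qed (simp add: mult.commute)
  obtain k where "w N / l N < (3 / 2) ^ k"
    using real_arch_pow[of "3/2" "w N / l N"] by auto
  then have "w N < (3 / 2) ^ k * l N" using l_pos[of N] by (simp add: field_simps)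
  moreover have "w (N + k) > 0" using l_pos[of "N+k"] l_le[of "N+k"] by linarith
  ultimately have "w N * w (N + k) < (3 / 2) ^ k * l N * w (N + k)" by simp
  also have "\<dots> \<le> w N * l (N + k)" by (rule growth)
  also have "\<dots> \<le> w N * w (N + k)"
    using l_le[of "N+k"] l_pos[of N] l_le[of N] by (intro mult_left_mono) auto
  finally show False by simp
qed

locale bs_line_C1 = bs_line +
  assumes a_Diff1: "a \<in> Diff1_real" and b_Diff1: "b \<in> Diff1_real"
begin

text \<open>If \<open>a\<close> moved \<open>u\<close>, the images of the gap under iterates of the
  inverse of \<open>a\<close> would march monotonically, trapped between \<open>p\<close> and
  \<open>p'\<close>, and shrink to a common fixed point of \<open>a\<close> and \<open>b\<close>.
  This contradicts \<open>no_shrinking_copies\<close>.\<close>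

lemma fixes_gap_endpoint:
  assumes gap: "gap b u v" and "a p = p" "p \<le> u" "a p' = p'" "u \<le> p'"
  shows "a u = u"
proof (rule ccontr)
  assume moved: "a u \<noteq> u"
  \<comment> \<open>The inverse is iterated, in whichever direction it moves \<open>u\<close>,
    because it carries the square of \<open>b\<close> back to \<open>b\<close> and so doubles
    displacements.\<close>
  define e where "e = inv a"
  have ae: "a (e y) = y" and ea: "e (a y) = y" for y
    using surj_a mono_a unfolding e_def by (simp_all add: surj_f_inv_f strict_mono_imp_inj_on)
  have mono_e: "strict_mono e"
    by (metis ae mono_a strict_mono_def strict_mono_less)
  have e_rel: "b (e x) = e (b (b x))" for x
    by (metis ae ea rel)
  have e_Diff1: "e \<in> Diff1_real" unfolding e_def by (rule Diff1_real_inv[OF a_Diff1])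
  have "e u \<noteq> u" using moved ae by metis
  have uv: "u < v" "b u = u" "b v = v" and free: "\<And>x. u < x \<Longrightarrow> x < v \<Longrightarrow> b x \<noteq> x"
    using gap by (auto simp: gap_def)
  have ep: "e p = p" "e p' = p'" using assms ea by metis+
  have em: "e x \<le> e y \<longleftrightarrow> x \<le> y" for x y using mono_e by (rule strict_mono_less_eq)
  have mono_en: "strict_mono (e ^^ n)" for n
    using mono_e by (induction n) (auto simp: strict_mono_def)
  have bounds: "p \<le> (e ^^ n) u" "(e ^^ n) u \<le> p'" for n
    using assms ep em by (induction n) (auto, metis+)
  have fix_e: "b (e z) = e z" if "b z = z" for z
    using e_rel[of z] that by simp
  have "\<exists>q. (\<lambda>n. (e ^^ n) u) \<longlonglongrightarrow> q \<and> (\<lambda>n. (e ^^ n) v) \<longlonglongrightarrow> q"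
  proof (cases "e u < u")
    case True
    \<comment> \<open>Otherwise \<open>a u\<close>, a fixed point of \<open>b\<close>, would lie
      inside the gap. Hence the iterates of \<open>v\<close> are squeezed between consecutive
      iterates of \<open>u\<close>.\<close>
    have "e v \<le> u"
    proof (rule ccontr)
      assume "\<not> e v \<le> u"
      then have "u < a u" "a u < v"
        using True mono_a ae by (metis strict_mono_less, metis not_le strict_mono_less)
      then show False using free a_fixed_b_iff uv by blast
    qed
    have "decseq (\<lambda>n. (e ^^ n) u)"
      using True strict_mono_less_eq[OF mono_en]
      by (intro decseq_SucI) (simp add: funpow_Suc_right del: funpow.simps(2))
    then obtain q where q: "(\<lambda>n. (e ^^ n) u) \<longlonglongrightarrow> q"
      using decseq_convergent[of _ p] bounds(1) by blast
    have "(\<lambda>n. (e ^^ Suc n) v) \<longlonglongrightarrow> q"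
    proof (rule tendsto_sandwich[OF _ _ LIMSEQ_Suc[OF q] q])
      show "\<forall>\<^sub>F n in sequentially. (e ^^ Suc n) u \<le> (e ^^ Suc n) v"
        using strict_mono_less_eq[OF mono_en] uv by (intro always_eventually) (simp del: funpow.simps)
      show "\<forall>\<^sub>F n in sequentially. (e ^^ Suc n) v \<le> (e ^^ n) u"
        using strict_mono_less_eq[OF mono_en] \<open>e v \<le> u\<close>
        by (intro always_eventually) (simp add: funpow_Suc_right del: funpow.simps(2))
    qed
    then have "(\<lambda>n. (e ^^ n) v) \<longlonglongrightarrow> q" by (rule LIMSEQ_imp_Suc)
    with q show ?thesis by blast
  next
    case False
    with \<open>e u \<noteq> u\<close> have "u < e u" by simp
    have "v \<le> e u" using free[of "e u"] fix_e uv \<open>u < e u\<close> by (meson not_le)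
    have "incseq (\<lambda>n. (e ^^ n) u)"
      using \<open>u < e u\<close> strict_mono_less_eq[OF mono_en]
      by (intro incseq_SucI) (simp add: funpow_Suc_right del: funpow.simps(2))
    then obtain q where q: "(\<lambda>n. (e ^^ n) u) \<longlonglongrightarrow> q"
      using incseq_convergent[of _ p'] bounds(2) by blast
    have "(\<lambda>n. (e ^^ n) v) \<longlonglongrightarrow> q"
    proof (rule tendsto_sandwich[OF _ _ q LIMSEQ_Suc[OF q]])
      show "\<forall>\<^sub>F n in sequentially. (e ^^ n) u \<le> (e ^^ n) v"
        using strict_mono_less_eq[OF mono_en] uv by (intro always_eventually) simp
      show "\<forall>\<^sub>F n in sequentially. (e ^^ n) v \<le> (e ^^ Suc n) u"
        using strict_mono_less_eq[OF mono_en] \<open>v \<le> e u\<close>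
        by (intro always_eventually) (simp add: funpow_Suc_right del: funpow.simps(2))
    qed
    with q show ?thesis by blast
  qed
  then obtain q where q: "(\<lambda>n. (e ^^ n) u) \<longlonglongrightarrow> q" "(\<lambda>n. (e ^^ n) v) \<longlonglongrightarrow> q" by blast
  have "(\<lambda>n. e ((e ^^ n) u)) \<longlonglongrightarrow> e q"
    using isCont_tendsto_compose[OF Diff1_real_isCont[OF e_Diff1] q(1)] .
  moreover have "(\<lambda>n. e ((e ^^ n) u)) \<longlonglongrightarrow> q" using LIMSEQ_Suc[OF q(1)] by simp
  ultimately have "e q = q" by (rule LIMSEQ_unique)
  then have "a q = q" using ae by metis
  have "b ((e ^^ n) u) = (e ^^ n) u" for n
    using uv fix_e by (induction n) auto
  then have "(\<lambda>n. b ((e ^^ n) u)) \<longlonglongrightarrow> q" using q by simp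
  moreover have "(\<lambda>n. b ((e ^^ n) u)) \<longlonglongrightarrow> b q"
    using isCont_tendsto_compose[OF isCont_b q(1)] .
  ultimately have "b q = q" by (metis LIMSEQ_unique)
  obtain e' where e': "continuous_on UNIV e'" "\<And>x. (e has_real_derivative e' x) (at x)" "\<And>x. e' x \<noteq> 0"
    by (rule Diff1_real_derivative[OF e_Diff1]) (rule that)
  have "e' q \<ge> 0"
    using mono_e e'(2) by (rule_tac mono_on_imp_deriv_nonneg[of UNIV e])
      (auto simp: strict_mono_mono mono_imp_mono_on)
  with e'(3)[of q] have "e' q > 0" by (simp add: less_le)
  obtain x where x: "u < x" "x < v" using dense uv by blast
  have "strict_deriv_at b 1 q"
    using a_Diff1 b_Diff1 rel \<open>a q = q\<close> \<open>b q = q\<close> by (rule common_fixed_strict_deriv_one)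
  with mono_e mono_b e_rel C1_strict_deriv_at[OF e'(1,2)] \<open>e' q > 0\<close> show False
    using uv(2,3) x free[OF x] q by (rule no_shrinking_copies)
qed

end

text \<open>Thurston's stability argument: infinitesimally at a common fixed point the displacements are
  additive, so that each relation forces the displacement of \<open>b\<close> to be negligible.\<close>

lemma displacement_estimate:
  fixes a b :: "real \<Rightarrow> real"
  assumes rel: "a (b x) = b (b (a x))"
    and a: "\<And>y z. \<bar>y - p\<bar> < r \<Longrightarrow> \<bar>z - p\<bar> < r \<Longrightarrow> \<bar>a y - a z - (y - z)\<bar> \<le> 1 / 20 * \<bar>y - z\<bar>"
    and b: "\<And>y z. \<bar>y - p\<bar> < r \<Longrightarrow> \<bar>z - p\<bar> < r \<Longrightarrow> \<bar>b y - b z - (y - z)\<bar> \<le> 1 / 20 * \<bar>y - z\<bar>"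
    and p: "a p = p" "b p = p" and x: "\<bar>x - p\<bar> < r / 2"
    and M: "\<bar>a x - x\<bar> \<le> M" "\<bar>b x - x\<bar> \<le> M"
  shows "\<bar>b x - x\<bar> \<le> 1 / 2 * M"
proof -
  have "0 < r" "\<bar>x - p\<bar> < r" using x by linarith+
  then have r: "\<bar>x - p\<bar> < r" "\<bar>p - p\<bar> < r" by simp_all
  have "\<bar>a x - x\<bar> \<le> 1 / 20 * \<bar>x - p\<bar>" "\<bar>b x - x\<bar> \<le> 1 / 20 * \<bar>x - p\<bar>"
    using a[OF r] b[OF r] p by simp_all
  then have le: "\<bar>a x - p\<bar> \<le> 21 / 20 * \<bar>x - p\<bar>" "\<bar>b x - p\<bar> \<le> 21 / 20 * \<bar>x - p\<bar>"
    using abs_triangle_ineq[of "a x - x" "x - p"] abs_triangle_ineq[of "b x - x" "x - p"] by simp_all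
  then have ax: "\<bar>a x - p\<bar> < r" and bx: "\<bar>b x - p\<bar> < r"
    using x abs_ge_zero[of "x - p"] by (simp_all del: abs_ge_zero)
  have "\<bar>b (a x) - a x\<bar> \<le> 1 / 20 * \<bar>a x - p\<bar>"
    using b[OF ax r(2)] p by simp
  then have bax: "\<bar>b (a x) - p\<bar> < r"
    using abs_triangle_ineq[of "b (a x) - a x" "a x - p"] le x \<open>0 < r\<close> by simp
  \<comment> \<open>Writing E1, E2, E3 for the three quantities whose absolute values are bounded
    here, the relation yields \<open>b x - x\<close> = E1 - E2 - E3.\<close>
  have 1: "\<bar>a (b x) - a x - (b x - x)\<bar> \<le> 1 / 20 * \<bar>b x - x\<bar>" using a[OF bx r(1)] .
  have 2: "\<bar>b (a x) - b x - (a x - x)\<bar> \<le> 1 / 20 * \<bar>a x - x\<bar>" using b[OF ax r(1)] .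
  have 3: "\<bar>b (b (a x)) - b x - (b (a x) - x)\<bar> \<le> 1 / 20 * \<bar>b (a x) - x\<bar>" using b[OF bax r(1)] .
  have "\<bar>b (a x) - x\<bar> \<le> \<bar>b (a x) - b x - (a x - x)\<bar> + \<bar>a x - x\<bar> + \<bar>b x - x\<bar>"
    by linarith
  moreover have "\<bar>b x - x\<bar> \<le> \<bar>a (b x) - a x - (b x - x)\<bar> + \<bar>b (a x) - b x - (a x - x)\<bar>
      + \<bar>b (b (a x)) - b x - (b (a x) - x)\<bar>"
    unfolding rel by linarith
  moreover have "0 \<le> M" using M by linarith
  ultimately show ?thesis using 1 2 3 M by simp
qed

text \<open>The filter form makes it easy to find one radius that serves all four
  generators.\<close>

lemma strict_deriv_at_eventually:
  assumes "strict_deriv_at f m p" "\<epsilon> > 0"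
  shows "\<forall>\<^sub>F r in at_right 0. \<forall>y z. \<bar>y - p\<bar> < r \<longrightarrow> \<bar>z - p\<bar> < r \<longrightarrow>
           \<bar>f y - f z - m * (y - z)\<bar> \<le> \<epsilon> * \<bar>y - z\<bar>"
proof -
  obtain r0 where "r0 > 0" "\<And>y z. \<bar>y - p\<bar> < r0 \<Longrightarrow> \<bar>z - p\<bar> < r0 \<Longrightarrow> \<bar>f y - f z - m * (y - z)\<bar> \<le> \<epsilon> * \<bar>y - z\<bar>"
    using assms unfolding strict_deriv_at_def by metis
  then show ?thesis
    unfolding eventually_at_right_field by (intro exI[of _ r0]) auto
qed

text \<open>Each relation bounds one of the four displacements by half of the largest, so the
  largest is 0.\<close>

lemma fixed_near_common_fixed_point:
  assumes ab: "bs_line_C1 a b" and bc: "bs_line_C1 b c" and cd: "bs_line_C1 c d" and da: "bs_line_C1 d a"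
    and p: "a p = p" "b p = p" "c p = p" "d p = p"
  shows "\<exists>r>0. \<forall>x. \<bar>x - p\<bar> < r \<longrightarrow> b x = x"
proof -
  have *: "strict_deriv_at g 1 p" if "bs_line_C1 f g" "f p = p" "g p = p" for f g
    using that common_fixed_strict_deriv_one[of f g p]
    by (auto simp: bs_line_C1_def bs_line_C1_axioms_def bs_line_def)
  have ev: "\<forall>\<^sub>F r in at_right 0. \<forall>y z. \<bar>y - p\<bar> < r \<longrightarrow> \<bar>z - p\<bar> < r \<longrightarrow> \<bar>g y - g z - (y - z)\<bar> \<le> 1 / 20 * \<bar>y - z\<bar>"
    if "bs_line_C1 f g" "f p = p" "g p = p" for f g
    using strict_deriv_at_eventually[OF *[OF that], of "1 / 20"] by simp
  have "\<forall>\<^sub>F r in at_right 0. r > (0::real)" by (rule eventually_at_right_less)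
  with ev[OF da p(4,1)] ev[OF ab p(1,2)] ev[OF bc p(2,3)] ev[OF cd p(3,4)]
  have "\<forall>\<^sub>F r in at_right 0. r > 0 \<and> (\<forall>g\<in>{a, b, c, d}. \<forall>y z. \<bar>y - p\<bar> < r \<longrightarrow> \<bar>z - p\<bar> < r \<longrightarrow>
      \<bar>g y - g z - (y - z)\<bar> \<le> 1 / 20 * \<bar>y - z\<bar>)"
    by eventually_elim blast
  then obtain r where "r > 0" and est: "\<And>g y z. g \<in> {a, b, c, d} \<Longrightarrow> \<bar>y - p\<bar> < r \<Longrightarrow> \<bar>z - p\<bar> < r \<Longrightarrow>
      \<bar>g y - g z - (y - z)\<bar> \<le> 1 / 20 * \<bar>y - z\<bar>"
    using eventually_happens'[OF trivial_limit_at_right_real] by blast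
  have gens: "a \<in> {a, b, c, d}" "b \<in> {a, b, c, d}" "c \<in> {a, b, c, d}" "d \<in> {a, b, c, d}" by auto
  have rels: "a (b x) = b (b (a x))" "b (c x) = c (c (b x))" "c (d x) = d (d (c x))" "d (a x) = a (a (d x))" for x
    using ab bc cd da by (auto simp: bs_line_C1_def bs_line_def)
  have "b x = x" if x: "\<bar>x - p\<bar> < r / 2" for x
  proof -
    define M where "M = Max {\<bar>a x - x\<bar>, \<bar>b x - x\<bar>, \<bar>c x - x\<bar>, \<bar>d x - x\<bar>}"
    have M: "\<bar>a x - x\<bar> \<le> M" "\<bar>b x - x\<bar> \<le> M" "\<bar>c x - x\<bar> \<le> M" "\<bar>d x - x\<bar> \<le> M"
      unfolding M_def by (rule Max_ge; simp)+
    have "M \<in> {\<bar>a x - x\<bar>, \<bar>b x - x\<bar>, \<bar>c x - x\<bar>, \<bar>d x - x\<bar>}"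
      unfolding M_def by (rule Max_in) auto
    moreover have "\<bar>b x - x\<bar> \<le> 1 / 2 * M"
      using rels(1) est[OF gens(1)] est[OF gens(2)] p(1,2) x M(1,2) by (rule displacement_estimate)
    moreover have "\<bar>c x - x\<bar> \<le> 1 / 2 * M"
      using rels(2) est[OF gens(2)] est[OF gens(3)] p(2,3) x M(2,3) by (rule displacement_estimate)
    moreover have "\<bar>d x - x\<bar> \<le> 1 / 2 * M"
      using rels(3) est[OF gens(3)] est[OF gens(4)] p(3,4) x M(3,4) by (rule displacement_estimate)
    moreover have "\<bar>a x - x\<bar> \<le> 1 / 2 * M"
      using rels(4) est[OF gens(4)] est[OF gens(1)] p(4,1) x M(4,1) by (rule displacement_estimate)
    ultimately have "M \<le> 1 / 2 * M" by (elim insertE emptyE) simp_all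
    then show ?thesis using M(2) by simp
  qed
  with \<open>r > 0\<close> show ?thesis by (intro exI[of _ "r / 2"]) simp
qed

subsection \<open>Actions on the line\<close>

text \<open>Boundedness passes from \<open>b\<close> to \<open>a\<close>, \<open>d\<close>,
  \<open>c\<close> and back to \<open>b\<close>, each time with a fixed point above all those of the
  preceding map. This yields the absurd chain \<open>p < q < s < t < p\<close>.\<close>

lemma bs_cycle_fixed_points_unbounded_above:
  assumes "bs_line a b" "bs_line b c" "bs_line c d" "bs_line d a"
  shows "\<not> bdd_above {x. b x = x}"
proof
  assume "bdd_above {x. b x = x}"
  with assms(1) obtain p where p: "bdd_above {x. a x = x}" "a p = p" "\<And>z. b z = z \<Longrightarrow> z < p"
    using bs_line.fixed_points_bdd_above_propagate by metis
  with assms(4) obtain q where q: "bdd_above {x. d x = x}" "d q = q" "\<And>z. a z = z \<Longrightarrow> z < q"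
    using bs_line.fixed_points_bdd_above_propagate by metis
  with assms(3) obtain s where s: "bdd_above {x. c x = x}" "c s = s" "\<And>z. d z = z \<Longrightarrow> z < s"
    using bs_line.fixed_points_bdd_above_propagate by metis
  with assms(2) obtain t where t: "b t = t" "\<And>z. c z = z \<Longrightarrow> z < t"
    using bs_line.fixed_points_bdd_above_propagate by metis
  show False
    using p(3)[OF t(1)] q(3)[OF p(2)] s(3)[OF q(2)] t(2)[OF s(2)] by linarith
qed

lemma bs_cycle_fixed_points_unbounded_below:
  assumes "bs_line a b" "bs_line b c" "bs_line c d" "bs_line d a"
  shows "\<not> bdd_below {x. b x = x}"
proof
  assume "bdd_below {x. b x = x}"
  then obtain m where m: "\<And>z. b z = z \<Longrightarrow> m \<le> z" by (auto simp: bdd_below_def)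
  have "x \<le> - m" if "- b (- x) = x" for x
    using m[of "- x"] that by linarith
  then have "bdd_above {x. - b (- x) = x}" by (auto simp: bdd_above_def)
  with bs_cycle_fixed_points_unbounded_above[OF assms[THEN bs_line.reflection]] show False by simp
qed

text \<open>The hypotheses are invariant under rotating the cycle, so a conclusion about
  \<open>b\<close> alone suffices.\<close>

lemma bs_line_C1_cycle_trivial:
  assumes ab: "bs_line_C1 a b" and bc: "bs_line_C1 b c" and cd: "bs_line_C1 c d" and da: "bs_line_C1 d a"
  shows "b x = x"
proof (rule ccontr)
  assume "b x \<noteq> x"
  note lines = ab[THEN bs_line_C1.axioms(1)] bc[THEN bs_line_C1.axioms(1)]
    cd[THEN bs_line_C1.axioms(1)] da[THEN bs_line_C1.axioms(1)]
  have unb: "\<not> bdd_above {x. b x = x}" "\<not> bdd_below {x. b x = x}"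
      "\<not> bdd_above {x. a x = x}" "\<not> bdd_below {x. a x = x}"
      "\<not> bdd_above {x. d x = x}" "\<not> bdd_below {x. d x = x}"
      "\<not> bdd_above {x. c x = x}" "\<not> bdd_below {x. c x = x}"
    using bs_cycle_fixed_points_unbounded_above[OF lines(1,2,3,4)]
      bs_cycle_fixed_points_unbounded_above[OF lines(2,3,4,1)]
      bs_cycle_fixed_points_unbounded_above[OF lines(3,4,1,2)]
      bs_cycle_fixed_points_unbounded_above[OF lines(4,1,2,3)]
      bs_cycle_fixed_points_unbounded_below[OF lines(1,2,3,4)]
      bs_cycle_fixed_points_unbounded_below[OF lines(2,3,4,1)]
      bs_cycle_fixed_points_unbounded_below[OF lines(3,4,1,2)]
      bs_cycle_fixed_points_unbounded_below[OF lines(4,1,2,3)] by blast+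
  \<comment> \<open>The cycle is traversed backwards: the left endpoint \<open>u\<close> passes from
    \<open>b\<close> to \<open>a\<close>, then to \<open>d\<close> and to \<open>c\<close>.\<close>
  have step: "f u = u \<and> (\<exists>w. gap f u w)"
    if fg: "bs_line_C1 f g" and gap: "\<exists>v. gap g u v" and unb: "\<not> bdd_above {x. f x = x}" "\<not> bdd_below {x. f x = x}"
    for f g u
  proof -
    obtain v where v: "gap g u v" using gap by blast
    obtain p p' where "f p = p" "p \<le> u" "f p' = p'" "u \<le> p'"
      using unb unfolding bdd_above_def bdd_below_def
      by (metis (mono_tags, lifting) linorder_le_cases mem_Collect_eq)
    then have "f u = u" using bs_line_C1.fixes_gap_endpoint[OF fg v] by blast
    with v show ?thesis using bs_line.gap_inherited[OF bs_line_C1.axioms(1)[OF fg]] by blast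
  qed
  obtain u v where gap: "gap b u v"
    using gap_around[OF bs_line.isCont_b[OF lines(1)] \<open>b x \<noteq> x\<close> unb(1,2)] by blast
  then have a: "a u = u \<and> (\<exists>w. gap a u w)" using step[OF ab _ unb(3,4)] by blast
  then have d: "d u = u \<and> (\<exists>w. gap d u w)" using step[OF da _ unb(5,6)] by blast
  then have c: "c u = u \<and> (\<exists>w. gap c u w)" using step[OF cd _ unb(7,8)] by blast
  have "b u = u" using gap by (simp add: gap_def)
  then obtain r where r: "r > 0" "\<And>x. \<bar>x - u\<bar> < r \<Longrightarrow> b x = x"
    using fixed_near_common_fixed_point[OF ab bc cd da] a c d by blast
  \<comment> \<open>A point both in the gap and in the neighbourhood of \<open>u\<close> where
    \<open>b\<close> is the identity.\<close>
  define y where "y = u + min (r / 2) ((v - u) / 2)"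
  have "u < y" "y < v" "\<bar>y - u\<bar> < r"
    using gap r(1) by (auto simp: y_def gap_def min_def field_simps)
  then show False using r(2) gap by (auto simp: gap_def)
qed

section \<open>Orientation, and the conclusion for the line\<close>

text \<open>If \<open>g\<close> were decreasing, its square would be increasing, so the two sides of
  the relation would have opposite monotonicity; the points 0 and 1 detect this.\<close>

lemma Diff1_real_strict_mono:
  assumes "f \<in> Diff1_real" "g \<in> Diff1_real" and rel: "\<And>x. f (g x) = g (g (f x))"
  shows "strict_mono g"
proof -
  have monotone: "strict_mono h \<or> monotone (<) (\<lambda>x y. y < x) h" if h: "h \<in> Diff1_real" for h
  proof -
    have "inj_on h UNIV" using h by (simp add: Diff1_real_def bij_is_inj)
    moreover have "continuous_on UNIV h"
      using Diff1_real_isCont[OF h] by (simp add: continuous_on_eq_continuous_at)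
    ultimately show ?thesis using injective_eq_monotone_map[of UNIV h] by simp
  qed
  show ?thesis
  proof (rule ccontr)
    assume "\<not> strict_mono g"
    then have g: "g y < g x" if "x < y" for x y
      using monotone[OF assms(2)] that by (auto simp: monotone_on_def)
    have g10: "g 1 < g 0" by (rule g) simp
    show False
    proof (cases "strict_mono f")
      case True
      then have f: "f x < f y" if "x < y" for x y
        using that by (rule strict_monoD)
      have "f (g 0) < f (g 1)" unfolding rel by (intro g f) simp
      then show False using f[OF g10] by simp
    next
      case False
      then have f: "f y < f x" if "x < y" for x y
        using monotone[OF assms(1)] that by (auto simp: monotone_on_def)
      have "f (g 1) < f (g 0)" unfolding rel by (intro g f) simp
      then show False using f[OF g10] by simp
    qed
  qed
qed

lemma higman_line_trivial:
  assumes "a \<in> Diff1_real" "b \<in> Diff1_real" "c \<in> Diff1_real" "d \<in> Diff1_real"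
    and rels: "\<And>x. a (b x) = b (b (a x))" "\<And>x. b (c x) = c (c (b x))"
      "\<And>x. c (d x) = d (d (c x))" "\<And>x. d (a x) = a (a (d x))"
  shows "a x = x \<and> b x = x \<and> c x = x \<and> d x = x"
proof -
  have bs: "bs_line_C1 f g"
    if "f \<in> Diff1_real" "g \<in> Diff1_real" "strict_mono f" "strict_mono g" "\<And>x. f (g x) = g (g (f x))" for f g
    using that by unfold_locales (auto simp: Diff1_real_def bij_is_surj)
  have mono: "strict_mono a" "strict_mono b" "strict_mono c" "strict_mono d"
    using Diff1_real_strict_mono[OF assms(4,1) rels(4)] Diff1_real_strict_mono[OF assms(1,2) rels(1)]
      Diff1_real_strict_mono[OF assms(2,3) rels(2)] Diff1_real_strict_mono[OF assms(3,4) rels(3)] by this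
  note cycle = bs[OF assms(1,2) mono(1,2) rels(1)] bs[OF assms(2,3) mono(2,3) rels(2)]
    bs[OF assms(3,4) mono(3,4) rels(3)] bs[OF assms(4,1) mono(4,1) rels(4)]
  show ?thesis
    using bs_line_C1_cycle_trivial[OF cycle(1,2,3,4)] bs_line_C1_cycle_trivial[OF cycle(2,3,4,1)]
      bs_line_C1_cycle_trivial[OF cycle(3,4,1,2)] bs_line_C1_cycle_trivial[OF cycle(4,1,2,3)] by simp
qed

subsection \<open>Lifting from the circle\<close>

lemma cis_eq_imp_int: "\<exists>n::int. x = y + 2 * pi * n" if "cis x = cis y"
  using that sin_cos_eq_iff[of x y] by (simp add: complex_eq_iff)

lemma cis_add_2pi_int: "cis (x + 2 * pi * of_int n) = cis x"
  by (simp flip: cis_mult)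

lemma in_S1_iff_cis: "z \<in> S1 \<longleftrightarrow> (\<exists>t. z = cis t)"
proof
  assume z: "z \<in> S1"
  then have "z \<noteq> 0" by (auto simp: S1_def)
  with z have "z = cis (Arg z)" by (simp add: S1_def cis_Arg sgn_eq)
  then show "\<exists>t. z = cis t" by blast
qed (auto simp: S1_def)

text \<open>Distinct values are at least \<open>2 * pi\<close> apart. It is applied to differences
  of lifts.\<close>

lemma continuous_2pi_int_constant:
  fixes f :: "real \<Rightarrow> real"
  assumes "\<And>t. isCont f t" "\<And>t. \<exists>n::int. f t = 2 * pi * n"
  shows "\<exists>n::int. \<forall>t. f t = 2 * pi * n"
proof -
  have "f constant_on UNIV"
  proof (rule continuous_discrete_range_constant)
    show "continuous_on UNIV f" using assms(1) by (simp add: continuous_at_imp_continuous_on)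
    have "2 * pi \<le> norm (f y - f x)" if "f y \<noteq> f x" for x y
    proof -
      obtain m n :: int where mn: "f y = 2 * pi * m" "f x = 2 * pi * n" using assms(2) by metis
      with that have "m \<noteq> n" by auto
      then have "1 \<le> \<bar>m - n\<bar>" by simp
      then have "1 \<le> \<bar>real_of_int m - real_of_int n\<bar>"
        by (metis of_int_1_le_iff of_int_abs of_int_diff)
      moreover have "f y - f x = 2 * pi * (real_of_int m - real_of_int n)"
        by (simp add: mn algebra_simps)
      ultimately show ?thesis by (simp add: abs_mult)
    qed
    then show "\<exists>e>0. \<forall>y. y \<in> UNIV \<and> f y \<noteq> f x \<longrightarrow> e \<le> norm (f y - f x)" for x
      by (intro exI[of _ "2 * pi"]) auto
  qed simp
  then obtain c where "\<And>t. f t = c" by (auto simp: constant_on_def)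
  with assms(2)[of 0] show ?thesis by auto
qed

text \<open>The lift is an antiderivative of the angular velocity, hence C^1 by
  construction.\<close>

lemma C1_circle_lift:
  assumes "C1_circle g"
  obtains F where "C1_real F" "\<And>t. cis (F t) = g (cis t)"
proof -
  define k where "k t = g (cis t)" for t
  obtain g' where g': "continuous_on UNIV g'" "\<And>t. (k has_vector_derivative g' t) (at t)"
    using assms unfolding C1_circle_def k_def by blast
  have k_norm: "cmod (k t) = 1" for t
  proof -
    have "cis t \<in> S1" by (simp add: S1_def)
    then have "k t \<in> S1" using assms by (auto simp: C1_circle_def k_def)
    then show ?thesis by (simp add: S1_def)
  qed
  have kk: "k t * cnj (k t) = 1" for t
    using k_norm by (simp add: complex_norm_square[symmetric])
  have k_cont: "continuous_on UNIV k"
    using g'(2) has_vector_derivative_continuous by (metis continuous_at_imp_continuous_on)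
  \<comment> \<open>The angular velocity of \<open>k\<close>: as \<open>k\<close> has modulus 1,
    \<open>g' t * cnj (k t)\<close> is purely imaginary.\<close>
  define h where "h t = Im (g' t * cnj (k t))" for t
  have h_cont: "continuous_on UNIV h"
    unfolding h_def by (intro continuous_intros g'(1) k_cont)
  have tangent: "g' t = \<i> * h t * k t" for t
  proof -
    have "((\<lambda>t. k t * cnj (k t)) has_vector_derivative k t * cnj (g' t) + g' t * cnj (k t)) (at t)"
      by (intro derivative_intros g'(2) has_vector_derivative_cnj)
    moreover have "((\<lambda>t. k t * cnj (k t)) has_vector_derivative 0) (at t)"
      unfolding kk by simp
    ultimately have "k t * cnj (g' t) + g' t * cnj (k t) = 0"
      by (rule vector_derivative_unique_at)
    then have "Re (g' t * cnj (k t)) = 0"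
      by (simp add: complex_eq_iff)
    then have "g' t * cnj (k t) = \<i> * h t"
      by (simp add: complex_eq_iff h_def)
    then have "g' t * (k t * cnj (k t)) = \<i> * h t * k t" by (simp add: algebra_simps)
    then show ?thesis using kk by simp
  qed
  obtain F0 where F0: "\<And>t. (F0 has_vector_derivative h t) (at t)"
    using einterval_antiderivative[of "-\<infinity>" "\<infinity>" h] h_cont
    by (auto simp: continuous_on_eq_continuous_at)
  \<comment> \<open>The initial angle is chosen so that the constant value of
    \<open>k t * cis (- F t)\<close> is 1.\<close>
  obtain \<theta> where \<theta>: "k 0 = cis \<theta>" using in_S1_iff_cis[of "k 0"] k_norm[of 0] by (auto simp: S1_def)
  define F where "F t = F0 t - F0 0 + \<theta>" for t
  have F: "(F has_real_derivative h t) (at t)" for t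
    unfolding F_def has_real_derivative_iff_has_vector_derivative
    by (auto intro!: derivative_eq_intros F0)
  have cis_F: "((\<lambda>t. cis (- F t)) has_vector_derivative - h t *\<^sub>R (\<i> * cis (- F t))) (at t)" for t
  proof -
    have "((\<lambda>t. - F t) has_derivative (\<lambda>s. s * (- h t))) (at t)"
    proof -
      have "(\<lambda>s. s * (- h t)) = (*) (- h t)" by (simp add: fun_eq_iff)
      then show ?thesis using DERIV_minus[OF F[of t]] by (simp only: has_field_derivative_def)
    qed
    from has_derivative_cis[OF this] show ?thesis
      by (simp add: has_vector_derivative_def)
  qed
  have "((\<lambda>t. k t * cis (- F t)) has_vector_derivative 0) (at t)" for t
    using has_vector_derivative_mult[OF g'(2)[of t] cis_F[of t]]
    by (simp add: tangent scaleR_conv_of_real)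
  then obtain c where c: "\<And>t. k t * cis (- F t) = c"
    using has_vector_derivative_zero_constant[of UNIV "\<lambda>t. k t * cis (- F t)"] by auto
  have "c = 1" using c[of 0] by (simp add: \<theta> F_def cis_mult)
  have "cis (F t) = k t" for t
  proof -
    have "cis (F t) = k t * cis (- F t) * cis (F t)" using c \<open>c = 1\<close> by simp
    also have "\<dots> = k t" by (simp add: cis_mult mult.assoc)
    finally show ?thesis .
  qed
  moreover have "C1_real F" using F h_cont unfolding C1_real_def by blast
  ultimately show thesis using that by (simp add: k_def)
qed

lemma C1_real_shift:
  assumes "C1_real f"
  shows "C1_real (\<lambda>t. f (t + s) + c)"
proof -
  obtain f' where f': "continuous_on UNIV f'" "\<And>x. (f has_real_derivative f' x) (at x)"
    using assms by (auto simp: C1_real_def)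
  have "((\<lambda>t. f (t + s) + c) has_real_derivative f' (t + s)) (at t)" for t
    using DERIV_shift[of f "f' (t + s)" t s] f'(2) by (auto intro!: derivative_eq_intros)
  moreover have "continuous_on UNIV (\<lambda>t. f' (t + s))"
    by (intro continuous_on_compose2[OF f'(1)] continuous_intros) auto
  ultimately show ?thesis unfolding C1_real_def by blast
qed

lemma Diff1_realI:
  assumes "C1_real f" "C1_real g" "\<And>x. f (g x) = x" "inj f"
  shows "f \<in> Diff1_real"
proof -
  have "inv f = g" by (metis assms(3,4) ext inv_f_eq)
  moreover have "bij f" using assms by (metis bijI surjI)
  ultimately show ?thesis using assms by (simp add: Diff1_real_def)
qed

lemma Diff1_real_add:
  assumes "f \<in> Diff1_real"
  shows "(\<lambda>t. f t + c) \<in> Diff1_real"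
proof (rule Diff1_realI)
  have f: "bij f" "C1_real f" "C1_real (inv f)" using assms by (auto simp: Diff1_real_def)
  show "C1_real (\<lambda>t. f t + c)" "C1_real (\<lambda>t. inv f (t + - c) + 0)"
    using C1_real_shift[OF f(2), of 0 c] C1_real_shift[OF f(3), of "- c" 0] by simp_all
  show "f (inv f (x + - c) + 0) + c = x" for x
    using f(1) by (simp add: bij_is_surj surj_f_inv_f)
  show "inj (\<lambda>t. f t + c)" using f(1) by (auto simp: inj_def bij_def)
qed

lemma lifts_differ_by_2pi_int:
  fixes F G :: "real \<Rightarrow> real"
  assumes "\<And>t. isCont F t" "\<And>t. isCont G t" "\<And>t. cis (F t) = cis (G t)"
  shows "\<exists>n::int. \<forall>t. F t = G t + 2 * pi * n"
proof -
  have "\<exists>n::int. \<forall>t. F t - G t = 2 * pi * n"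
  proof (rule continuous_2pi_int_constant)
    show "\<exists>n::int. F t - G t = 2 * pi * n" for t
      using cis_eq_imp_int[OF assms(3)[of t]] by auto
  qed (intro continuous_intros assms)
  then show ?thesis by (auto simp: algebra_simps)
qed

text \<open>Lifts \<open>F\<close> of \<open>g\<close> and \<open>G\<close> of its inverse compose
  to translations, so a shift of \<open>G\<close> is a C^1 inverse of \<open>F\<close>.\<close>

lemma Diff1_circle_lift:
  assumes "g \<in> Diff1_circle"
  obtains F where "F \<in> Diff1_real" "\<And>t. cis (F t) = g (cis t)"
proof -
  have bij: "bij_betw g S1 S1" and C1: "C1_circle g" "C1_circle (inv_into S1 g)"
    using assms by (auto simp: Diff1_circle_def)
  obtain F where F: "C1_real F" "\<And>t. cis (F t) = g (cis t)"
    using C1_circle_lift[OF C1(1)] by metis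
  obtain G where G: "C1_real G" "\<And>t. cis (G t) = inv_into S1 g (cis t)"
    using C1_circle_lift[OF C1(2)] by metis
  have "cis (F (G t)) = cis t" "cis (G (F t)) = cis t" for t
    using bij F(2) G(2) in_S1_iff_cis[of "cis t"]
    by (auto simp: bij_betw_inv_into_left bij_betw_inv_into_right)
  moreover have cont: "isCont F t" "isCont G t" for t using F G C1_real_isCont by auto
  then have "isCont (\<lambda>t. F (G t)) t" "isCont (\<lambda>t. G (F t)) t" for t
    by (auto intro: isCont_o2)
  ultimately obtain m n :: int where m: "\<And>t. F (G t) = t + 2 * pi * m" and n: "\<And>t. G (F t) = t + 2 * pi * n"
    using lifts_differ_by_2pi_int[of "\<lambda>t. F (G t)" "\<lambda>t. t"] lifts_differ_by_2pi_int[of "\<lambda>t. G (F t)" "\<lambda>t. t"] by auto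
  have "F \<in> Diff1_real"
  proof (rule Diff1_realI[OF F(1)])
    show "C1_real (\<lambda>t. G (t + - 2 * pi * m) + 0)" by (rule C1_real_shift[OF G(1)])
    show "F (G (x + - 2 * pi * m) + 0) = x" for x by (simp add: m)
    show "inj F" by (rule injI) (metis n add_right_cancel)
  qed
  then show thesis using F(2) by (rule that)
qed

text \<open>\<open>n\<close> is the degree of \<open>g\<close>; it is nonzero because
  \<open>F\<close> is injective.\<close>

lemma lift_degree:
  assumes F: "F \<in> Diff1_real" "\<And>t. cis (F t) = g (cis t)"
  obtains n :: int where "n \<noteq> 0" "\<And>t (j::int). F (t + 2 * pi * j) = F t + 2 * pi * (n * j)"
proof -
  have "cis (F (t + 2 * pi)) = cis (F t)" for t
    using F(2)[of "t + 2 * pi"] F(2)[of t] cis_add_2pi_int[of t 1] by simp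
  moreover have "isCont (\<lambda>t. F (t + 2 * pi)) t" for t
    by (intro isCont_o2[OF _ Diff1_real_isCont[OF F(1)]] continuous_intros)
  ultimately obtain n :: int where n: "\<And>t. F (t + 2 * pi) = F t + 2 * pi * n"
    using lifts_differ_by_2pi_int[of "\<lambda>t. F (t + 2 * pi)" F] Diff1_real_isCont[OF F(1)] by auto
  have "F (t + 2 * pi * j) = F t + 2 * pi * (n * j)" for t and j :: int
  proof (induction j rule: int_induct[where k = 0])
    case (step1 i)
    then show ?case using n[of "t + 2 * pi * i"] by (simp add: algebra_simps)
  next
    case (step2 i)
    then show ?case using n[of "t + 2 * pi * (i - 1)"] by (simp add: algebra_simps)
  qed simp
  moreover have "n \<noteq> 0"
  proof
    assume "n = 0"
    then have "F (0 + 2 * pi) = F 0" using n[of 0] by simp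
    then have "0 + 2 * pi = 0" using F(1) unfolding Diff1_real_def by (auto dest!: bij_is_inj injD)
    then show False by simp
  qed
  ultimately show thesis using that by blast
qed

section \<open>Lifting the Higman relations\<close>

text \<open>\<open>k\<close> is the defect of the lifted relation. Comparing degrees gives
  \<open>m * n = n * (n * m)\<close> with nonzero factors, so \<open>b\<close> has degree 1.\<close>

lemma lift_relation:
  assumes A: "A \<in> Diff1_real" "\<And>t. cis (A t) = a (cis t)"
    and B: "B \<in> Diff1_real" "\<And>t. cis (B t) = b (cis t)"
    and rel: "\<And>z. z \<in> S1 \<Longrightarrow> a (b z) = b (b (a z))"
  obtains k :: int where "\<And>t. A (B t) = B (B (A t)) + 2 * pi * k"
    "\<And>t (j::int). B (t + 2 * pi * j) = B t + 2 * pi * j"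
proof -
  note cont = Diff1_real_isCont[OF A(1)] Diff1_real_isCont[OF B(1)]
  have "cis (A (B t)) = cis (B (B (A t)))" for t
    using rel[of "cis t"] by (simp add: A B S1_def)
  moreover have "isCont (\<lambda>t. A (B t)) t" "isCont (\<lambda>t. B (B (A t))) t" for t
    by (intro isCont_o2[OF _ cont(1)] isCont_o2[OF _ cont(2)] cont)+
  ultimately obtain k :: int where k: "\<And>t. A (B t) = B (B (A t)) + 2 * pi * k"
    using lifts_differ_by_2pi_int[of "\<lambda>t. A (B t)" "\<lambda>t. B (B (A t))"] by blast
  obtain m :: int where m: "m \<noteq> 0" "\<And>t (j::int). A (t + 2 * pi * j) = A t + 2 * pi * (m * j)"
    using lift_degree[OF A] by metis
  obtain n :: int where n: "n \<noteq> 0" "\<And>t (j::int). B (t + 2 * pi * j) = B t + 2 * pi * (n * j)"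
    using lift_degree[OF B] by metis
  have "n = 1"
  proof -
    have "A (B (0 + 2 * pi * (1::int))) = A (B 0) + 2 * pi * (m * n)"
      unfolding n m of_int_mult[symmetric] by simp
    moreover have "B (B (A (0 + 2 * pi * (1::int)))) = B (B (A 0)) + 2 * pi * (n * (n * m))"
      unfolding n m of_int_mult[symmetric] by simp
    ultimately have "2 * pi * (m * n) = 2 * pi * (n * (n * m))"
      using k[of 0] k[of "0 + 2 * pi * (1::int)"] by simp
    then have "real_of_int (m * n) = real_of_int (n * (n * m))" by simp
    then have "m * n = n * (n * m)" by (simp only: of_int_eq_iff)
    with m(1) n(1) show ?thesis by simp
  qed
  with k n(2) show thesis by (intro that) simp_all
qed

text \<open>The shift of \<open>B\<close> enters once on the left and twice on the right, which
  cancels the defect \<open>k\<close>; the shift of \<open>A\<close> by \<open>i\<close> contributes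
  equally to both sides.\<close>

lemma shifted_lift_relation:
  fixes A B :: "real \<Rightarrow> real" and i k :: int
  assumes A: "\<And>t (j::int). A (t + 2 * pi * j) = A t + 2 * pi * j"
    and B: "\<And>t (j::int). B (t + 2 * pi * j) = B t + 2 * pi * j"
    and rel: "\<And>t. A (B t) = B (B (A t)) + 2 * pi * k"
  shows "A (B t + 2 * pi * k) + 2 * pi * i = B (B (A t + 2 * pi * i) + 2 * pi * k) + 2 * pi * k"
  by (simp add: A B rel)

text \<open>Replacing a lift \<open>B\<close> of \<open>b\<close> by \<open>B + 2 \<pi> k\<close> changes only the relation in which \<open>b\<close> is squared,
  so the four defects can be removed independently and the circle action lifts to the line.\<close>

lemma higman_circle_trivial:
  assumes "a \<in> Diff1_circle" "b \<in> Diff1_circle" "c \<in> Diff1_circle" "d \<in> Diff1_circle"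
    and rels: "\<And>z. z \<in> S1 \<Longrightarrow> a (b z) = b (b (a z))" "\<And>z. z \<in> S1 \<Longrightarrow> b (c z) = c (c (b z))"
      "\<And>z. z \<in> S1 \<Longrightarrow> c (d z) = d (d (c z))" "\<And>z. z \<in> S1 \<Longrightarrow> d (a z) = a (a (d z))"
    and "z \<in> S1"
  shows "a z = z \<and> b z = z \<and> c z = z \<and> d z = z"
proof -
  obtain A where A: "A \<in> Diff1_real" "\<And>t. cis (A t) = a (cis t)"
    using Diff1_circle_lift[OF assms(1)] by metis
  obtain B where B: "B \<in> Diff1_real" "\<And>t. cis (B t) = b (cis t)"
    using Diff1_circle_lift[OF assms(2)] by metis
  obtain C where C: "C \<in> Diff1_real" "\<And>t. cis (C t) = c (cis t)"
    using Diff1_circle_lift[OF assms(3)] by metis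
  obtain D where D: "D \<in> Diff1_real" "\<And>t. cis (D t) = d (cis t)"
    using Diff1_circle_lift[OF assms(4)] by metis
  obtain kb :: int where kb: "\<And>t. A (B t) = B (B (A t)) + 2 * pi * kb"
    "\<And>t (j::int). B (t + 2 * pi * j) = B t + 2 * pi * j"
    by (rule lift_relation[OF A B rels(1)]) (auto intro: that)
  obtain kc :: int where kc: "\<And>t. B (C t) = C (C (B t)) + 2 * pi * kc"
    "\<And>t (j::int). C (t + 2 * pi * j) = C t + 2 * pi * j"
    by (rule lift_relation[OF B C rels(2)]) (auto intro: that)
  obtain kd :: int where kd: "\<And>t. C (D t) = D (D (C t)) + 2 * pi * kd"
    "\<And>t (j::int). D (t + 2 * pi * j) = D t + 2 * pi * j"
    by (rule lift_relation[OF C D rels(3)]) (auto intro: that)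
  obtain ka :: int where ka: "\<And>t. D (A t) = A (A (D t)) + 2 * pi * ka"
    "\<And>t (j::int). A (t + 2 * pi * j) = A t + 2 * pi * j"
    by (rule lift_relation[OF D A rels(4)]) (auto intro: that)
  obtain t where z: "z = cis t" using \<open>z \<in> S1\<close> in_S1_iff_cis by blast
  \<comment> \<open>The corrected lifts satisfy the relations exactly, so they are the identity;
    \<open>cis\<close> forgets the corrections.\<close>
  have "A t + 2 * pi * ka = t \<and> B t + 2 * pi * kb = t \<and> C t + 2 * pi * kc = t \<and> D t + 2 * pi * kd = t"
    by (rule higman_line_trivial; (rule Diff1_real_add A B C D
      shifted_lift_relation[OF ka(2) kb(2,1)] shifted_lift_relation[OF kb(2) kc(2,1)]
      shifted_lift_relation[OF kc(2) kd(2,1)] shifted_lift_relation[OF kd(2) ka(2,1)])+)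
  then show ?thesis
    unfolding z using A(2) B(2) C(2) D(2) cis_add_2pi_int by metis
qed

text \<open>Circle maps are functions on the whole complex plane with arbitrary values off
  \<open>S1\<close>, so the group operations are restricted to \<open>S1\<close> and triviality is
  asserted on \<open>S1\<close> only.\<close>

theorem theoremB:
  shows "(\<forall>a b c d. a \<in> Diff1_real \<and> b \<in> Diff1_real \<and> c \<in> Diff1_real \<and> d \<in> Diff1_real \<and>
            higman_rels (\<circ>) inv a b c d
          \<longrightarrow> a = id \<and> b = id \<and> c = id \<and> d = id)
       \<and> (\<forall>a b c d. a \<in> Diff1_circle \<and> b \<in> Diff1_circle \<and> c \<in> Diff1_circle \<and> d \<in> Diff1_circle \<and>
            higman_rels (\<lambda>f g. restrict (f \<circ> g) S1) (\<lambda>f. restrict (inv_into S1 f) S1) a b c d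
          \<longrightarrow> (\<forall>z\<in>S1. a z = z \<and> b z = z \<and> c z = z \<and> d z = z))"
proof -
  \<comment> \<open>Evaluating the relation at \<open>f x\<close> cancels the inverse and gives the
    form used above.\<close>
  have line: "f (g x) = g (g (f x))" if "f \<in> Diff1_real" and eq: "f \<circ> g \<circ> inv f = g \<circ> g" for f g x
  proof -
    have "inv f (f x) = x" using \<open>f \<in> Diff1_real\<close> by (simp add: Diff1_real_def bij_is_inj)
    then show ?thesis using fun_cong[OF eq, of "f x"] by simp
  qed
  have circle: "f (g z) = g (g (f z))"
    if f: "f \<in> Diff1_circle" and "z \<in> S1"
      and eq: "restrict (restrict (f \<circ> g) S1 \<circ> restrict (inv_into S1 f) S1) S1 = restrict (g \<circ> g) S1" for f g z
  proof -
    have bij: "bij_betw f S1 S1" using f by (simp add: Diff1_circle_def)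
    with \<open>z \<in> S1\<close> have "f z \<in> S1" "inv_into S1 f (f z) = z"
      by (auto simp: bij_betw_inv_into_left bij_betw_apply)
    then show ?thesis using fun_cong[OF eq, of "f z"] \<open>z \<in> S1\<close> by simp
  qed
  show ?thesis
  proof (intro conjI allI impI; (elim conjE)?)
    fix a b c d :: "real \<Rightarrow> real"
    assume D: "a \<in> Diff1_real" "b \<in> Diff1_real" "c \<in> Diff1_real" "d \<in> Diff1_real"
      and H: "higman_rels (\<circ>) inv a b c d"
    have "a x = x \<and> b x = x \<and> c x = x \<and> d x = x" for x
      using D by (rule higman_line_trivial)
        (use H in \<open>auto simp: higman_rels_def intro: line[OF D(1)] line[OF D(2)] line[OF D(3)] line[OF D(4)]\<close>)
    then show "a = id" "b = id" "c = id" "d = id" by auto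
  next
    fix a b c d :: "complex \<Rightarrow> complex"
    assume D: "a \<in> Diff1_circle" "b \<in> Diff1_circle" "c \<in> Diff1_circle" "d \<in> Diff1_circle"
      and H: "higman_rels (\<lambda>f g. restrict (f \<circ> g) S1) (\<lambda>f. restrict (inv_into S1 f) S1) a b c d"
    note rels = H[unfolded higman_rels_def]
    show "\<forall>z\<in>S1. a z = z \<and> b z = z \<and> c z = z \<and> d z = z"
    proof
      fix z assume "z \<in> S1"
      then show "a z = z \<and> b z = z \<and> c z = z \<and> d z = z"
        using rels by (intro higman_circle_trivial[OF D] circle D) simp_all
    qed
  qed
qed

end
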